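(* Let $\rho$ be a two-qubit density matrix. The real $4\times4$ matrix $R$ with elements $R_{ij}=\operatorname{Tr}(\rho(\sigma_i\otimes\sigma_j))$, $i,j\in\{0,1,2,3\}$, can be decomposed as $$R=L_1\Sigma L_2^T$$ with $L_1,L_2$ proper orthochronous Lorentz transformations, and $\Sigma$ either of diagonal form $\Sigma=\operatorname{diag}[s_0,s_1,s_2,s_3]$ with $s_0\ge s_1\ge s_2\ge|s_3|$, or of the form $$\Sigma=\begin{pmatrix}a&0&0&b\\0&d&0&0\\0&0&-d&0\\c&0&0&a+c-b\end{pmatrix}$$ with $a,b,c,d$ real.
   Context: A two-qubit density matrix is a positive semidefinite complex $4\times4$ matrix on $\mathbb{C}^2\otimes\mathbb{C}^2$ of trace one. $\sigma_0=I_2$ and $\sigma_1=\begin{pmatrix}0&1\\1&0\end{pmatrix}$, $\sigma_2=\begin{pmatrix}0&-i\\i&0\end{pmatrix}$, $\sigma_3=\begin{pmatrix}1&0\\0&-1\end{pmatrix}$ are the Pauli matrices. With $M=\operatorname{diag}[1,-1,-1,-1]$, a proper orthochronous Lorentz transformation is a real $4\times4$ matrix $L$ (indices $0,\dots,3$) with $LML^T=M$, $\det L=1$ and $L_{00}>0$. *)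

theory Defs
  imports "HOL-Analysis.Analysis"
begin

text \<open>
  Lorentz indices are the elements \<open>0, 1, 2, 3\<close> of the numeral type \<open>4\<close>. The library's
  \<open>vector\<close> starts at index \<open>1\<close> and would put its last entry at \<open>4 = 0\<close>; \<open>vec4\<close> starts at \<open>0\<close>.
  A nested \<open>vec4\<close> is a \<open>4 \<times> 4\<close> matrix listed by rows.
\<close>

definition vec4 :: "'a \<Rightarrow> 'a \<Rightarrow> 'a \<Rightarrow> 'a \<Rightarrow> 'a ^ 4" where
  "vec4 x0 x1 x2 x3 =
     (\<chi> i. if i = 0 then x0 else if i = 1 then x1 else if i = 2 then x2 else x3)"

lemma vec4_nth [simp]:
  "vec4 x0 x1 x2 x3 $ 0 = x0"
  "vec4 x0 x1 x2 x3 $ 1 = x1"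
  "vec4 x0 x1 x2 x3 $ 2 = x2"
  "vec4 x0 x1 x2 x3 $ 3 = x3"
  by (simp_all add: vec4_def)

definition diag4 :: "real \<Rightarrow> real \<Rightarrow> real \<Rightarrow> real \<Rightarrow> real ^ 4 ^ 4" where
  "diag4 s0 s1 s2 s3 =
     vec4 (vec4 s0 0 0 0)
          (vec4 0 s1 0 0)
          (vec4 0 0 s2 0)
          (vec4 0 0 0 s3)"

definition pauli :: "4 \<Rightarrow> complex ^ 2 ^ 2" where
  "pauli i =
     vec4 (mat 1)
          (vector [vector [0, 1], vector [1, 0]])
          (vector [vector [0, - \<i>], vector [\<i>, 0]])
          (vector [vector [1, 0], vector [0, - 1]]) $ i"

text \<open>
  The standard basis of the tensor product of two spaces with bases indexed by \<open>'m\<close> and \<open>'n\<close>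
  is indexed by \<open>'m \<times> 'n\<close>, so operators on \<open>\<complex>\<^sup>2 \<otimes> \<complex>\<^sup>2\<close> have rows and columns in \<open>2 \<times> 2\<close>.
\<close>

definition tensor :: "complex ^ 'm ^ 'm \<Rightarrow> complex ^ 'n ^ 'n \<Rightarrow> complex ^ ('m \<times> 'n) ^ ('m \<times> 'n)"
    (infixl "\<otimes>" 70) where
  "A \<otimes> B = (\<chi> p q. A $ fst p $ fst q * B $ snd p $ snd q)"

definition hermitian :: "complex ^ 'n ^ 'n \<Rightarrow> bool" where
  "hermitian A \<longleftrightarrow> (\<forall>i j. A $ i $ j = cnj (A $ j $ i))"

definition pos_semidef :: "complex ^ 'n ^ 'n \<Rightarrow> bool" where
  "pos_semidef A \<longleftrightarrow>
     hermitian A \<and> (\<forall>v. 0 \<le> Re (\<Sum>i\<in>UNIV. \<Sum>j\<in>UNIV. cnj (v $ i) * A $ i $ j * v $ j))"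

definition two_qubit_density :: "complex ^ (2 \<times> 2) ^ (2 \<times> 2) \<Rightarrow> bool" where
  "two_qubit_density \<rho> \<longleftrightarrow> pos_semidef \<rho> \<and> trace \<rho> = 1"

text \<open>
  The traces below are real when \<open>\<rho>\<close> is Hermitian (lemma \<open>of_real_corr_matrix\<close>), so that
  \<open>Re\<close> only converts the type.
\<close>

definition corr_matrix :: "complex ^ (2 \<times> 2) ^ (2 \<times> 2) \<Rightarrow> real ^ 4 ^ 4" where
  "corr_matrix \<rho> = (\<chi> i j. Re (trace (\<rho> ** (pauli i \<otimes> pauli j))))"

lemma hermitian_pauli: "hermitian (pauli i)"
  by (auto simp: hermitian_def pauli_def vec4_def mat_def forall_2)

lemma hermitian_tensor:
  assumes "hermitian A" and "hermitian B"
  shows "hermitian (A \<otimes> B)"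
  using assms unfolding hermitian_def tensor_def
  by (metis (no_types, lifting) complex_cnj_mult vec_lambda_beta)

lemma trace_hermitian_mult_real:
  assumes "hermitian A" and "hermitian B"
  shows "trace (A ** B) \<in> \<real>"
proof -
  have "cnj (trace (A ** B)) = (\<Sum>i\<in>UNIV. \<Sum>k\<in>UNIV. cnj (A $ i $ k) * cnj (B $ k $ i))"
    by (simp add: trace_def matrix_matrix_mult_def)
  also have "\<dots> = (\<Sum>i\<in>UNIV. \<Sum>k\<in>UNIV. A $ k $ i * B $ i $ k)"
    using assms unfolding hermitian_def by (intro sum.cong refl) metis
  also have "\<dots> = (\<Sum>k\<in>UNIV. \<Sum>i\<in>UNIV. A $ k $ i * B $ i $ k)"
    by (rule sum.swap)
  also have "\<dots> = trace (A ** B)"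
    by (simp add: trace_def matrix_matrix_mult_def)
  finally show ?thesis
    by (simp add: Reals_cnj_iff)
qed

lemma of_real_corr_matrix:
  assumes "two_qubit_density \<rho>"
  shows "complex_of_real (corr_matrix \<rho> $ i $ j) = trace (\<rho> ** (pauli i \<otimes> pauli j))"
  using assms trace_hermitian_mult_real[OF _ hermitian_tensor[OF hermitian_pauli hermitian_pauli]]
  by (simp add: corr_matrix_def two_qubit_density_def pos_semidef_def)

definition minkowski :: "real ^ 4 ^ 4" where
  "minkowski = diag4 1 (- 1) (- 1) (- 1)"

definition proper_orthochronous :: "real ^ 4 ^ 4 \<Rightarrow> bool" where
  "proper_orthochronous L \<longleftrightarrow>
     L ** minkowski ** transpose L = minkowski \<and> det L = 1 \<and> L $ 0 $ 0 > 0"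

end

theory Submission
  imports Defs
begin

text \<open>
  Local filtering \<open>\<rho> \<mapsto> (A \<otimes> B) \<rho> (A \<otimes> B)\<^sup>*\<close> with \<open>det A = det B = 1\<close> acts on \<open>R\<close> as multiplication by Lorentz
  transformations from the left and the right, so one looks for a good representative of the orbit.

  If \<open>\<langle>\<alpha> \<otimes> \<beta>, \<rho> (\<alpha> \<otimes> \<beta>)\<rangle>\<close> never vanishes on unit vectors, then \<open>Tr \<rho>'\<close> is coercive on the orbit, and so is
  the weighted sum \<open>7 S\<^sub>0\<^sub>0 - 3 S\<^sub>1\<^sub>1 - 2 S\<^sub>2\<^sub>2 - S\<^sub>3\<^sub>3\<close> of the diagonal of the transformed matrix \<open>S\<close>. At a
  minimizer, stationarity along boosts and rotations on either side kills all off-diagonal entries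
  because the weights are distinct in absolute value, and comparison with quarter turns orders the diagonal.

  Otherwise a product vector lies in the kernel of \<open>\<rho>\<close>, and local unitaries move it to \<open>e\<^sub>1 \<otimes> e\<^sub>2\<close>. Unipotent
  filters then remove the coherences between \<open>e\<^sub>2 \<otimes> e\<^sub>1\<close> and the other basis vectors, which is possible since
  \<open>\<rho>\<close> is positive semidefinite, and a phase makes the last coherence real. This yields the non-diagonal form.
\<close>

section \<open>Index sums and entries of the Pauli matrices\<close>

lemma UNIV_4_from_0: "(UNIV :: 4 set) = {0, 1, 2, 3}"
  using UNIV_4 by auto

lemma forall_4_from_0: "(\<forall>i::4. P i) \<longleftrightarrow> P 0 \<and> P 1 \<and> P 2 \<and> P 3"
  by (metis UNIV_4_from_0 UNIV_I insertE singletonD)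

lemma sum_4_from_0: "(\<Sum>i\<in>(UNIV::4 set). f i) = f 0 + f 1 + f 2 + (f 3 :: 'a::comm_monoid_add)"
proof -
  have "(\<Sum>i\<in>(UNIV::4 set). f i) = f 1 + f 2 + f 3 + f 4"
    by (rule sum_4)
  also have "(4 :: 4) = 0" by simp
  finally show ?thesis by (simp add: add_ac)
qed

lemma sum_UNIV_prod: "(\<Sum>p\<in>UNIV. f p) = (\<Sum>a\<in>UNIV. \<Sum>b\<in>UNIV. f (a, b))"
  by (simp add: sum.cartesian_product)

lemma pauli_simps [simp]:
  "pauli 0 = mat 1"
  "pauli 1 = vector [vector [0, 1], vector [1, 0]]"
  "pauli 2 = vector [vector [0, - \<i>], vector [\<i>, 0]]"
  "pauli 3 = vector [vector [1, 0], vector [0, - 1]]"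
  by (simp_all add: pauli_def)

section \<open>Adjoints and positive semidefinite matrices\<close>

definition adj :: "complex ^ 'm ^ 'n \<Rightarrow> complex ^ 'n ^ 'm" where
  "adj A = (\<chi> i j. cnj (A $ j $ i))"

lemma adj_nth [simp]: "adj A $ i $ j = cnj (A $ j $ i)"
  by (simp add: adj_def)

lemma adj_adj [simp]: "adj (adj A) = A"
  by (simp add: vec_eq_iff)

lemma adj_mult: "adj (A ** B) = adj B ** adj A"
  by (simp add: vec_eq_iff matrix_matrix_mult_def mult.commute)

lemma hermitian_iff_adj: "hermitian A \<longleftrightarrow> adj A = A"
  by (simp add: vec_eq_iff hermitian_def eq_commute)

lemma hermitian_congr: "hermitian A \<Longrightarrow> hermitian (Z ** A ** adj Z)"
  by (simp add: hermitian_iff_adj adj_mult matrix_mul_assoc)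

definition cdot :: "complex ^ 'n \<Rightarrow> complex ^ 'n \<Rightarrow> complex" where
  "cdot u w = (\<Sum>i\<in>UNIV. cnj (u $ i) * w $ i)"

lemma cdot_adj: "cdot (adj Z *v u) w = cdot u (Z *v w)"
proof -
  have "cdot (adj Z *v u) w = (\<Sum>i\<in>UNIV. \<Sum>j\<in>UNIV. Z $ j $ i * cnj (u $ j) * w $ i)"
    by (simp add: cdot_def matrix_vector_mult_def sum_distrib_right)
  also have "\<dots> = (\<Sum>j\<in>UNIV. \<Sum>i\<in>UNIV. Z $ j $ i * cnj (u $ j) * w $ i)"
    by (rule sum.swap)
  also have "\<dots> = cdot u (Z *v w)"
    by (simp add: cdot_def matrix_vector_mult_def sum_distrib_left mult_ac)
  finally show ?thesis .
qed

lemma cdot_add_left: "cdot (u + v) w = cdot u w + cdot v w"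
  by (simp add: cdot_def algebra_simps sum.distrib)

lemma cdot_add_right: "cdot w (u + v) = cdot w u + cdot w v"
  by (simp add: cdot_def algebra_simps sum.distrib)

lemma cdot_scale_left: "cdot (c *s u) w = cnj c * cdot u w"
  by (simp add: cdot_def sum_distrib_left mult_ac)

lemma cdot_scale_right: "cdot w (c *s u) = c * cdot w u"
  by (simp add: cdot_def sum_distrib_left mult_ac)

lemma cdot_self: "cdot u u = of_real ((norm u)\<^sup>2)"
  unfolding cdot_def norm_vec_def L2_set_def
  by (simp add: sum_nonneg complex_norm_square[symmetric] mult.commute flip: of_real_power)

lemma pos_semidef_iff:
  "pos_semidef A \<longleftrightarrow> hermitian A \<and> (\<forall>v. 0 \<le> Re (cdot v (A *v v)))"
  by (simp add: pos_semidef_def cdot_def matrix_vector_mult_def sum_distrib_left mult.assoc)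

lemma pos_semidef_congr:
  assumes "pos_semidef A"
  shows "pos_semidef (Z ** A ** adj Z)"
proof -
  have "cdot v ((Z ** A ** adj Z) *v v) = cdot (adj Z *v v) (A *v (adj Z *v v))" for v
    by (simp add: cdot_adj matrix_vector_mul_assoc[symmetric])
  with assms show ?thesis
    by (simp add: pos_semidef_iff hermitian_congr)
qed

text \<open>Evaluate the form at \<open>w - s v\<close> with \<open>w = A *v v\<close>. Because the
  form vanishes at \<open>v\<close>, the result is affine in the real number \<open>s\<close> with
  slope \<open>- 2 * (norm w)\<^sup>2\<close>. It is nonnegative for every \<open>s\<close>, so the
  slope is zero.\<close>

lemma pos_semidef_kernel:
  assumes A: "pos_semidef A" and z: "Re (cdot v (A *v v)) = 0"
  shows "A *v v = 0"
proof -
  define w where "w = A *v v"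
  have adjA: "adj A = A"
    using A by (simp add: pos_semidef_iff hermitian_iff_adj)
  have vAw: "cdot v (A *v w) = cdot w w"
    by (metis adjA cdot_adj w_def)
  have ineq: "0 \<le> Re (cdot w (A *v w)) - 2 * s * (norm w)\<^sup>2" for s :: real
  proof -
    let ?u = "w + (- of_real s) *s v"
    have "0 \<le> Re (cdot ?u (A *v ?u))"
      using A by (simp add: pos_semidef_iff)
    also have "cdot ?u (A *v ?u) = cdot w (A *v w) - 2 * s * cdot w w + s\<^sup>2 * cdot v (A *v v)"
      unfolding matrix_vector_right_distrib vector_scalar_commute cdot_add_left cdot_add_right
          cdot_scale_left cdot_scale_right vAw w_def[symmetric]
      by (simp add: algebra_simps power2_eq_square)
    finally show ?thesis
      using z by (simp add: cdot_self)
  qed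
  have "norm w = 0"
  proof (rule ccontr)
    assume "norm w \<noteq> 0"
    then show False
      \<comment> \<open>This \<open>s\<close> makes the right side of \<open>ineq\<close> equal to
        \<open>- 1\<close>.\<close>
      using ineq[of "(Re (cdot w (A *v w)) + 1) / (2 * (norm w)\<^sup>2)"] by simp
  qed
  then show ?thesis
    by (simp add: w_def)
qed

lemma cdot_axis: "cdot (axis i 1) w = w $ i"
  by (simp add: cdot_def axis_def if_distrib if_distribR cong: if_cong)

lemma matrix_axis: "(A *v axis j 1) $ i = (A $ i $ j :: complex)"
  by (simp add: matrix_vector_mult_def axis_def if_distrib if_distribR cong: if_cong)

text \<open>The diagonal entry is the value of the form at a basis vector, which
  \<open>pos_semidef_kernel\<close> therefore puts into the kernel.\<close>

lemma pos_semidef_diag_zero: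
  assumes "pos_semidef A" and "A $ k $ k = 0"
  shows "A $ i $ k = 0" and "A $ k $ i = 0"
proof -
  have "A *v axis k 1 = 0"
    using assms by (intro pos_semidef_kernel) (simp_all add: cdot_axis matrix_axis)
  then show "A $ i $ k = 0"
    by (metis matrix_axis zero_index)
  then show "A $ k $ i = 0"
    using assms unfolding pos_semidef_def hermitian_def by (metis complex_cnj_zero)
qed

lemma Re_trace_nonneg: "pos_semidef A \<Longrightarrow> 0 \<le> Re (trace A)"
  unfolding trace_def Re_sum pos_semidef_iff
  by (intro sum_nonneg) (metis cdot_axis matrix_axis)

lemma matrix_add_rdistrib: "(A + B) ** C = A ** C + B ** (C :: 'a::semiring_1 ^ 'n ^ 'm)"
  by (simp add: vec_eq_iff matrix_matrix_mult_def sum.distrib distrib_right)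

text \<open>For an involution, the square of \<open>mat 1 + U\<close> is twice
  \<open>mat 1 + U\<close>. By cyclicity, \<open>trace A + trace (A ** U)\<close> is then half the
  trace of a congruence of \<open>A\<close>, which is positive semidefinite. The two signs come from
  \<open>U\<close> and \<open>- U\<close>.\<close>

lemma trace_involution_bound:
  assumes A: "pos_semidef A" and U: "hermitian U" "U ** U = mat 1"
  shows "\<bar>Re (trace (A ** U))\<bar> \<le> Re (trace A)"
proof -
  have *: "0 \<le> Re (trace A) + Re (trace (A ** U))" if U: "hermitian U" "U ** U = mat 1" for U
  proof -
    let ?V = "mat 1 + U"
    have adjV: "adj ?V = ?V"
      using U by (auto simp add: hermitian_iff_adj vec_eq_iff mat_def)
    have VV: "?V ** ?V = ?V + ?V"
      by (simp add: matrix_add_ldistrib matrix_add_rdistrib U)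
    have "0 \<le> Re (trace (?V ** A ** adj ?V))"
      by (intro Re_trace_nonneg pos_semidef_congr A)
    also have "trace (?V ** A ** adj ?V) = trace (A ** (?V ** ?V))"
      unfolding adjV by (metis matrix_mul_assoc trace_mul_sym)
    also have "\<dots> = 2 * (trace A + trace (A ** U))"
      unfolding VV unfolding matrix_add_ldistrib trace_add matrix_mul_rid by simp
    finally show ?thesis by simp
  qed
  have "hermitian (- U)" "(- U) ** (- U) = mat 1"
    using U by (simp_all add: hermitian_iff_adj vec_eq_iff matrix_matrix_mult_def)
  from *[OF U] *[OF this] show ?thesis
    by (simp add: trace_def matrix_matrix_mult_def sum_negf)
qed

section \<open>The Pauli matrices as an orthogonal basis of the Hermitian matrices, and tensor
  products\<close>

lemma pauli_expand:
  assumes "hermitian (H :: complex ^ 2 ^ 2)"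
  shows "H $ a $ b = (\<Sum>k\<in>UNIV. of_real (Re (trace (H ** pauli k)) / 2) * pauli k $ a $ b)"
proof -
  have h: "H $ 1 $ 1 = cnj (H $ 1 $ 1)" "H $ 2 $ 2 = cnj (H $ 2 $ 2)" "H $ 1 $ 2 = cnj (H $ 2 $ 1)"
    using assms unfolding hermitian_def by blast+
  have "\<forall>a b. H $ a $ b = (\<Sum>k\<in>UNIV. of_real (Re (trace (H ** pauli k)) / 2) * pauli k $ a $ b)"
    using h
    by (simp add: forall_2 sum_4_from_0 trace_def matrix_matrix_mult_def sum_2 mat_def complex_eq_iff flip: add_divide_distrib)
  then show ?thesis by blast
qed

lemma pauli_orthogonal: "trace (pauli i ** pauli k) = (if i = k then 2 else 0)"
proof -
  have "\<forall>i k. trace (pauli i ** pauli k) = (if i = k then 2 else 0)"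
    by (simp add: forall_4_from_0 trace_def matrix_matrix_mult_def sum_2 mat_def)
  then show ?thesis by blast
qed

lemma pauli_square: "pauli i ** pauli i = mat 1"
proof -
  have "\<forall>i. pauli i ** pauli i = mat 1"
    by (simp add: forall_4_from_0 vec_eq_iff forall_2 matrix_matrix_mult_def sum_2 mat_def)
  then show ?thesis by blast
qed

lemma tensor_mult: "(A \<otimes> B) ** (C \<otimes> D) = (A ** C) \<otimes> (B ** D)"
  by (simp add: vec_eq_iff tensor_def matrix_matrix_mult_def sum_product sum_UNIV_prod mult_ac)

lemma adj_tensor: "adj (A \<otimes> B) = adj A \<otimes> adj B"
  by (simp add: vec_eq_iff tensor_def)

lemma tensor_one: "mat 1 \<otimes> mat 1 = mat 1"
  by (simp add: vec_eq_iff tensor_def mat_def prod_eq_iff)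

section \<open>The homomorphism from SL(2, C) to the Lorentz group\<close>

definition lor :: "complex ^ 2 ^ 2 \<Rightarrow> real ^ 4 ^ 4" where
  "lor A = (\<chi> i k. Re (trace (adj A ** pauli i ** A ** pauli k)) / 2)"

lemma lor_00:
  "lor A $ 0 $ 0 = ((norm (A$1$1))\<^sup>2 + (norm (A$1$2))\<^sup>2 + (norm (A$2$1))\<^sup>2 + (norm (A$2$2))\<^sup>2) / 2"
  by (simp add: lor_def trace_def matrix_matrix_mult_def sum_2 mat_def cmod_power2 algebra_simps)
   (simp add: power2_eq_square)

lemma lor_uminus: "lor (- A) = lor A"
proof -
  have "adj (- A) ** B ** (- A) = adj A ** B ** A" for B
    by (simp add: vec_eq_iff matrix_matrix_mult_def sum_negf)
  then show ?thesis by (simp add: lor_def)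
qed

text \<open>Row \<open>i\<close> of \<open>lor A\<close> holds the Pauli coordinates of the
  conjugate of \<open>pauli i\<close>. The adjoint stands on the left because cyclicity of the trace
  moves a filter from the state to the observables in this form.\<close>

lemma lor_action: "(adj A ** pauli i ** A) $ a $ b = (\<Sum>k\<in>UNIV. of_real (lor A $ i $ k) * pauli k $ a $ b)"
proof -
  have "hermitian (adj A ** pauli i ** A)"
    using hermitian_congr[OF hermitian_pauli, of "adj A"] by simp
  from pauli_expand[OF this] show ?thesis
    by (simp add: lor_def)
qed


text \<open>Pauli coordinates are unique: the trace against \<open>pauli l\<close> isolates the
  coefficient of index \<open>l\<close> by orthogonality.\<close>

lemma lor_eqI:
  assumes "\<And>i a b. (adj A ** pauli i ** A) $ a $ b = (\<Sum>k\<in>UNIV. of_real (L $ i $ k) * pauli k $ a $ b)"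
  shows "lor A = L"
proof -
  have "lor A $ i $ l = L $ i $ l" for i l
  proof -
    have "trace (adj A ** pauli i ** A ** pauli l) =
      (\<Sum>a\<in>UNIV. \<Sum>b\<in>UNIV. \<Sum>k\<in>UNIV. of_real (L $ i $ k) * (pauli k $ a $ b * pauli l $ b $ a))"
      by (simp add: trace_def matrix_matrix_mult_def[of _ "pauli l"] assms sum_distrib_right mult.assoc)
    also have "\<dots> = (\<Sum>k\<in>UNIV. of_real (L $ i $ k) * trace (pauli k ** pauli l))"
      by (simp add: trace_def matrix_matrix_mult_def sum_2 sum.distrib distrib_left)
    also have "\<dots> = 2 * of_real (L $ i $ l)"
      by (simp add: pauli_orthogonal if_distrib cong: if_cong)
    finally show ?thesis
      by (simp add: lor_def)
  qed
  then show ?thesis by (simp add: vec_eq_iff)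
qed

text \<open>Conjugation by \<open>A ** B\<close> conjugates by \<open>A\<close> first and by
  \<open>B\<close> second. Since coordinates are stored in rows, the order of the factors is
  kept.\<close>

lemma lor_mult: "lor (A ** B) = lor A ** lor B"
proof (rule lor_eqI)
  fix i a b
  have "(adj (A ** B) ** pauli i ** (A ** B)) $ a $ b = (adj B ** (adj A ** pauli i ** A) ** B) $ a $ b"
    by (simp add: adj_mult matrix_mul_assoc)
  also have "\<dots> = (\<Sum>j\<in>UNIV. of_real (lor A $ i $ j) * (adj B ** pauli j ** B) $ a $ b)"
    unfolding matrix_matrix_mult_def[of _ B] matrix_matrix_mult_def[of "adj B"]
    by (simp add: lor_action sum_2 sum_4_from_0 algebra_simps)
  also have "\<dots> = (\<Sum>j\<in>UNIV. \<Sum>k\<in>UNIV. of_real (lor A $ i $ j * lor B $ j $ k) * pauli k $ a $ b)"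
    by (simp add: lor_action sum_distrib_left mult.assoc)
  also have "\<dots> = (\<Sum>k\<in>UNIV. \<Sum>j\<in>UNIV. of_real (lor A $ i $ j * lor B $ j $ k) * pauli k $ a $ b)"
    by (rule sum.swap)
  also have "\<dots> = (\<Sum>k\<in>UNIV. of_real ((lor A ** lor B) $ i $ k) * pauli k $ a $ b)"
    by (simp add: matrix_matrix_mult_def sum_distrib_right)
  finally show "(adj (A ** B) ** pauli i ** (A ** B)) $ a $ b =
    (\<Sum>k\<in>UNIV. of_real ((lor A ** lor B) $ i $ k) * pauli k $ a $ b)" .
qed

text \<open>The polarization of \<open>2 det\<close>, which the Pauli matrices identify with the Minkowski form.\<close>
definition mixed_det :: "complex ^ 2 ^ 2 \<Rightarrow> complex ^ 2 ^ 2 \<Rightarrow> complex" where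
  "mixed_det X Y = X$1$1 * Y$2$2 + X$2$2 * Y$1$1 - X$1$2 * Y$2$1 - X$2$1 * Y$1$2"

text \<open>This is multiplicativity of the determinant in polarized form.\<close>

lemma mixed_det_mult: "mixed_det (B ** X ** A) (B ** Y ** A) = det B * det A * mixed_det X Y"
  by (simp add: mixed_det_def det_2 matrix_matrix_mult_def sum_2) algebra

lemma mixed_det_pauli: "mixed_det (pauli k) (pauli l) = 2 * of_real (minkowski $ k $ l)"
proof -
  have "\<forall>k l. mixed_det (pauli k) (pauli l) = 2 * of_real (minkowski $ k $ l)"
    by (simp add: forall_4_from_0 mixed_det_def mat_def minkowski_def diag4_def)
  then show ?thesis by blast
qed

lemma det_adj: "det (adj A) = cnj (det A)" for A :: "complex ^ 2 ^ 2"
  by (simp add: det_2)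

text \<open>Conjugation by a matrix of determinant one preserves \<open>mixed_det\<close>, which on
  Pauli matrices is twice the Minkowski form. Expanding both arguments in Pauli coordinates turns
  this invariance into the claim.\<close>

lemma lor_minkowski:
  assumes "det A = 1"
  shows "lor A ** minkowski ** transpose (lor A) = minkowski"
proof -
  have "(lor A ** minkowski ** transpose (lor A)) $ i $ j = minkowski $ i $ j" for i j
  proof -
    have "2 * complex_of_real (minkowski $ i $ j) = mixed_det (adj A ** pauli i ** A) (adj A ** pauli j ** A)"
      by (simp add: mixed_det_mult det_adj assms mixed_det_pauli)
    also have "\<dots> = (\<Sum>l\<in>UNIV. \<Sum>k\<in>UNIV. of_real (lor A $ i $ k * lor A $ j $ l) * mixed_det (pauli k) (pauli l))"
      unfolding mixed_det_def lor_action
      by (simp add: sum_4_from_0 mat_def algebra_simps)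
    also have "\<dots> = 2 * of_real ((lor A ** minkowski ** transpose (lor A)) $ i $ j)"
      by (simp add: mixed_det_pauli matrix_matrix_mult_def transpose_def sum_distrib_left sum_distrib_right mult_ac)
    finally show ?thesis
      using of_real_eq_iff by fastforce
  qed
  then show ?thesis by (simp add: vec_eq_iff)
qed

text \<open>
  Up to sign, which \<open>lor\<close> does not see, every \<open>A\<close> of determinant one is a square, by Cayley-Hamilton:
  \<open>(A + 1)\<^sup>2 = (trace A + 2) A\<close>.
\<close>
lemma det_lor:
  assumes A: "det A = 1"
  shows "det (lor A) = 1"
proof -
  have *: "det (lor A) = 1" if A: "det A = 1" and t: "trace A \<noteq> - 2" for A
  proof -
    define s where "s = csqrt (trace A + 2)"
    have s2: "s * s = trace A + 2"
      by (metis power2_csqrt power2_eq_square s_def)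
    have s0: "s \<noteq> 0"
      using s2 t by (auto simp: add_eq_0_iff2)
    \<comment> \<open>The divisor normalizes the determinant:
      \<open>det (A + mat 1) = det A + trace A + 1 = s * s\<close>.\<close>
    define B where "B = (\<chi> i j. (A $ i $ j + mat 1 $ i $ j) / s)"
    have "det B = ((A$1$1 + 1) * (A$2$2 + 1) - A$1$2 * A$2$1) / (s * s)"
      by (simp add: B_def det_2 mat_def diff_divide_distrib)
    also have "(A$1$1 + 1) * (A$2$2 + 1) - A$1$2 * A$2$1 = s * s"
      using A by (simp add: s2 trace_def sum_2 det_2 algebra_simps)
    finally have detB: "det B = 1"
      using s0 by simp
    define C where "C = A + mat 1"
    have "\<forall>i j. C $ i $ 1 * C $ 1 $ j + C $ i $ 2 * C $ 2 $ j = s * s * A $ i $ j"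
      using A unfolding s2 det_2 C_def by (simp add: forall_2 mat_def trace_def sum_2) algebra
    then have "(B ** B) $ i $ j = A $ i $ j" for i j
      using s0 by (simp add: B_def matrix_matrix_mult_def sum_2 flip: C_def add_divide_distrib vector_add_component)
    then have BB: "B ** B = A"
      by (simp add: vec_eq_iff)
    \<comment> \<open>The invariant form determines \<open>det (lor B)\<close> only up to sign, but
      \<open>lor A\<close> is the square of \<open>lor B\<close>.\<close>
    have "det (lor B ** minkowski ** transpose (lor B)) = det minkowski"
      by (simp add: lor_minkowski[OF detB])
    moreover have "det minkowski \<noteq> 0"
    proof -
      have "minkowski ** minkowski = mat 1"
        by (simp add: vec_eq_iff forall_4_from_0 matrix_matrix_mult_def sum_4_from_0 mat_def minkowski_def diag4_def)
      then show ?thesis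
        by (metis det_I det_mul mult_zero_left zero_neq_one)
    qed
    ultimately have "det (lor B) * det (lor B) = 1"
      by (simp add: det_mul det_transpose)
    then show ?thesis
      by (simp add: BB[symmetric] lor_mult det_mul)
  qed
  show ?thesis
  proof (cases "trace A = - 2")
    case True
    then have "trace (- A) \<noteq> - 2"
      by (simp add: trace_def sum_negf)
    moreover have "det (- A) = 1"
      using A by (simp add: det_2)
    ultimately show ?thesis
      using * lor_uminus by metis
  qed (use * A in blast)
qed

text \<open>By \<open>lor_00\<close> this entry is half the sum of the squared moduli of the entries
  of \<open>A\<close>, which vanishes only for the zero matrix.\<close>

lemma lor_00_pos:
  assumes "det A = 1"
  shows "lor A $ 0 $ 0 > 0"
proof -
  have "lor A $ 0 $ 0 \<ge> 0"
    by (simp add: lor_00)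
  moreover have "lor A $ 0 $ 0 \<noteq> 0"
    using assms by (auto simp: lor_00 det_2 add_nonneg_eq_0_iff)
  ultimately show ?thesis by simp
qed

lemma proper_orthochronous_lor: "det A = 1 \<Longrightarrow> proper_orthochronous (lor A)"
  by (simp add: proper_orthochronous_def lor_minkowski det_lor lor_00_pos)

section \<open>Local filtering and its action on the correlation matrix\<close>

lemma trace_mult_tensor:
  "trace (\<rho> ** (X \<otimes> Y)) = (\<Sum>p\<in>UNIV. \<Sum>q\<in>UNIV. \<rho> $ p $ q * (X $ fst q $ fst p * Y $ snd q $ snd p))"
  by (simp add: trace_def matrix_matrix_mult_def tensor_def)

lemma sum_swap3:
  "(\<Sum>p\<in>P. \<Sum>q\<in>Q. \<Sum>k\<in>K. f p q k) = (\<Sum>k\<in>K. \<Sum>p\<in>P. \<Sum>q\<in>Q. f p q k)"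
proof -
  have "(\<Sum>p\<in>P. \<Sum>q\<in>Q. \<Sum>k\<in>K. f p q k) = (\<Sum>p\<in>P. \<Sum>k\<in>K. \<Sum>q\<in>Q. f p q k)"
    by (intro sum.cong refl sum.swap)
  also have "\<dots> = (\<Sum>k\<in>K. \<Sum>p\<in>P. \<Sum>q\<in>Q. f p q k)"
    by (rule sum.swap)
  finally show ?thesis .
qed

text \<open>Cyclicity moves the filter onto \<open>pauli i \<otimes> pauli j\<close>, where it acts
  on each factor separately. There \<open>lor_action\<close> expands both factors.\<close>

lemma corr_matrix_local:
  "corr_matrix ((A \<otimes> B) ** \<rho> ** adj (A \<otimes> B)) = lor A ** corr_matrix \<rho> ** transpose (lor B)"
proof -
  let ?Z = "A \<otimes> B"
  have "corr_matrix (?Z ** \<rho> ** adj ?Z) $ i $ j = (lor A ** corr_matrix \<rho> ** transpose (lor B)) $ i $ j" for i j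
  proof -
    have "trace (?Z ** \<rho> ** adj ?Z ** (pauli i \<otimes> pauli j)) = trace (\<rho> ** (adj ?Z ** (pauli i \<otimes> pauli j) ** ?Z))"
      by (metis matrix_mul_assoc trace_mul_sym)
    also have "\<dots> = trace (\<rho> ** ((adj A ** pauli i ** A) \<otimes> (adj B ** pauli j ** B)))"
      by (simp add: adj_tensor tensor_mult)
    also have "\<dots> = (\<Sum>p\<in>UNIV. \<Sum>q\<in>UNIV. \<rho> $ p $ q *
        (\<Sum>k\<in>UNIV. \<Sum>l\<in>UNIV. of_real (lor A $ i $ k) * of_real (lor B $ j $ l) * (pauli k $ fst q $ fst p * pauli l $ snd q $ snd p)))"
      by (simp add: trace_mult_tensor lor_action sum_product mult_ac)
    also have "\<dots> = (\<Sum>p\<in>UNIV. \<Sum>q\<in>UNIV. \<Sum>k\<in>UNIV. \<Sum>l\<in>UNIV. of_real (lor A $ i $ k) * of_real (lor B $ j $ l) *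
        (\<rho> $ p $ q * (pauli k $ fst q $ fst p * pauli l $ snd q $ snd p)))"
      by (simp add: sum_distrib_left mult_ac)
    also have "\<dots> = (\<Sum>k\<in>UNIV. \<Sum>l\<in>UNIV. \<Sum>p\<in>UNIV. \<Sum>q\<in>UNIV. of_real (lor A $ i $ k) * of_real (lor B $ j $ l) *
        (\<rho> $ p $ q * (pauli k $ fst q $ fst p * pauli l $ snd q $ snd p)))"
      by (subst sum_swap3) (intro sum.cong refl sum_swap3)
    also have "\<dots> = (\<Sum>k\<in>UNIV. \<Sum>l\<in>UNIV. of_real (lor A $ i $ k * lor B $ j $ l) * trace (\<rho> ** (pauli k \<otimes> pauli l)))"
      by (simp add: trace_mult_tensor sum_distrib_left)
    finally have "corr_matrix (?Z ** \<rho> ** adj ?Z) $ i $ j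
       = (\<Sum>k\<in>UNIV. \<Sum>l\<in>UNIV. lor A $ i $ k * lor B $ j $ l * corr_matrix \<rho> $ k $ l)"
      by (simp add: corr_matrix_def)
    also have "\<dots> = (\<Sum>l\<in>UNIV. \<Sum>k\<in>UNIV. lor A $ i $ k * lor B $ j $ l * corr_matrix \<rho> $ k $ l)"
      by (rule sum.swap)
    also have "\<dots> = (lor A ** corr_matrix \<rho> ** transpose (lor B)) $ i $ j"
      by (simp add: matrix_matrix_mult_def transpose_def sum_distrib_right sum_distrib_left mult_ac)
    finally show ?thesis .
  qed
  then show ?thesis by (simp add: vec_eq_iff)
qed

text \<open>Filtered matrices are not renormalized, so the trace may change along an orbit while
  positive semidefiniteness persists.\<close>

definition loc_equiv :: "complex ^ (2 \<times> 2) ^ (2 \<times> 2) \<Rightarrow> complex ^ (2 \<times> 2) ^ (2 \<times> 2) \<Rightarrow> bool" where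
  "loc_equiv \<rho> \<rho>' \<longleftrightarrow> (\<exists>A B. det A = 1 \<and> det B = 1 \<and> \<rho>' = (A \<otimes> B) ** \<rho> ** adj (A \<otimes> B))"

lemma loc_equiv_trans:
  assumes "loc_equiv \<rho> \<rho>'" "loc_equiv \<rho>' \<rho>''"
  shows "loc_equiv \<rho> \<rho>''"
proof -
  obtain A B where AB: "det A = 1" "det B = 1" "\<rho>' = (A \<otimes> B) ** \<rho> ** adj (A \<otimes> B)"
    using assms by (auto simp: loc_equiv_def)
  obtain C D where CD: "det C = 1" "det D = 1" "\<rho>'' = (C \<otimes> D) ** \<rho>' ** adj (C \<otimes> D)"
    using assms by (auto simp: loc_equiv_def)
  have "det (C ** A) = 1" "det (D ** B) = 1"
    using AB CD by (simp_all add: det_mul)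
  moreover have "\<rho>'' = ((C ** A) \<otimes> (D ** B)) ** \<rho> ** adj ((C ** A) \<otimes> (D ** B))"
    by (simp add: AB CD adj_mult tensor_mult[symmetric] matrix_mul_assoc)
  ultimately show ?thesis
    unfolding loc_equiv_def by blast
qed

lemma loc_equiv_pos_semidef: "loc_equiv \<rho> \<rho>' \<Longrightarrow> pos_semidef \<rho> \<Longrightarrow> pos_semidef \<rho>'"
  by (auto simp: loc_equiv_def pos_semidef_congr)

lemma lor_one: "lor (mat 1) = mat 1"
  by (rule lor_eqI) (simp add: vec_eq_iff adj_def mat_def matrix_matrix_mult_def if_distrib if_distribR cong: if_cong)

text \<open>Inverting both filters, again with determinant one, carries a normal form found at
  \<open>\<rho>'\<close> back to \<open>\<rho>\<close>.\<close>

lemma loc_equiv_corr: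
  assumes "loc_equiv \<rho> \<rho>'"
  shows "\<exists>L1 L2. proper_orthochronous L1 \<and> proper_orthochronous L2 \<and>
    corr_matrix \<rho> = L1 ** corr_matrix \<rho>' ** transpose L2"
proof -
  have inv: "\<exists>C. det C = 1 \<and> C ** A = mat 1" if "det A = 1" for A :: "complex ^ 2 ^ 2"
    using that by (metis det_I det_mul invertible_det_nz invertible_def mult.commute mult.right_neutral zero_neq_one)
  obtain A B where AB: "det A = 1" "det B = 1" "\<rho>' = (A \<otimes> B) ** \<rho> ** adj (A \<otimes> B)"
    using assms by (auto simp: loc_equiv_def)
  obtain C D where CD: "det C = 1" "C ** A = mat 1" "det D = 1" "D ** B = mat 1"
    using inv AB by metis
  have "lor C ** corr_matrix \<rho>' ** transpose (lor D) = lor (C ** A) ** corr_matrix \<rho> ** transpose (lor (D ** B))"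
    by (simp add: AB corr_matrix_local lor_mult matrix_transpose_mul matrix_mul_assoc)
  also have "\<dots> = corr_matrix \<rho>"
    by (simp add: CD lor_one)
  finally show ?thesis
    using CD proper_orthochronous_lor by metis
qed

section \<open>Normal form when the quadratic form vanishes at a product vector\<close>

definition tvec :: "complex ^ 'm \<Rightarrow> complex ^ 'n \<Rightarrow> complex ^ ('m \<times> 'n)" where
  "tvec \<alpha> \<beta> = (\<chi> p. \<alpha> $ fst p * \<beta> $ snd p)"

lemma adj_tensor_axis:
  "adj (A \<otimes> B) *v axis p 1 = tvec (\<chi> i. cnj (A $ fst p $ i)) (\<chi> i. cnj (B $ snd p $ i))"
  by (simp add: vec_eq_iff matrix_axis tensor_def tvec_def)

text \<open>With \<open>adj_tensor_axis\<close>, the diagonal entries after a local filter become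
  values of the form of \<open>\<rho>\<close> at product vectors. Both cases of the proof rest on
  this.\<close>

lemma congr_diag:
  "(Z ** \<rho> ** adj Z) $ p $ p = cdot (adj Z *v axis p 1) (\<rho> *v (adj Z *v axis p 1))"
  by (simp add: cdot_adj cdot_axis matrix_vector_mul_assoc matrix_axis matrix_mul_assoc)

lemma norm_cnj_prod: "norm v = 1 \<Longrightarrow> (v :: complex^2) $ 1 * cnj (v $ 1) + v $ 2 * cnj (v $ 2) = 1"
  using cdot_self[of v] by (simp add: cdot_def sum_2 mult.commute)

lemma null_product_to_basis:
  fixes \<alpha> \<beta> :: "complex ^ 2"
  assumes \<rho>: "pos_semidef \<rho>" and n: "norm \<alpha> = 1" "norm \<beta> = 1"
    and z: "Re (cdot (tvec \<alpha> \<beta>) (\<rho> *v tvec \<alpha> \<beta>)) = 0"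
  shows "\<exists>\<rho>'. loc_equiv \<rho> \<rho>' \<and> \<rho>' $ (1,2) $ (1,2) = 0"
proof -
  \<comment> \<open>These are unitaries of determinant one. The first row of \<open>A\<close> is the
    conjugate of \<open>\<alpha>\<close> and the second row of \<open>B\<close> that of
    \<open>\<beta>\<close>; the other row completes each to an orthonormal basis.\<close>
  define A B :: "complex^2^2"
    where "A = vector [vector [cnj (\<alpha>$1), cnj (\<alpha>$2)], vector [- \<alpha>$2, \<alpha>$1]]"
      and "B = vector [vector [\<beta>$2, - \<beta>$1], vector [cnj (\<beta>$1), cnj (\<beta>$2)]]"
  have "det A = 1" "det B = 1"
    using n[THEN norm_cnj_prod] by (simp_all add: det_2 A_def B_def algebra_simps)
  moreover have "adj (A \<otimes> B) *v axis (1,2) 1 = tvec \<alpha> \<beta>"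
    by (simp add: adj_tensor_axis A_def B_def tvec_def vec_eq_iff forall_2)
  then have "((A \<otimes> B) ** \<rho> ** adj (A \<otimes> B)) $ (1,2) $ (1,2) = 0"
    using pos_semidef_kernel[OF \<rho> z] by (simp add: congr_diag cdot_def)
  ultimately show ?thesis
    unfolding loc_equiv_def by blast
qed

lemma tensor_congr_nth:
  "((A \<otimes> B) ** \<rho> ** adj (A \<otimes> B)) $ p $ q =
    (\<Sum>r\<in>UNIV. \<Sum>s\<in>UNIV. (A $ fst p $ fst s * B $ snd p $ snd s) * \<rho> $ s $ r *
       (cnj (A $ fst q $ fst r) * cnj (B $ snd q $ snd r)))"
  by (simp add: matrix_matrix_mult_def tensor_def sum_distrib_right)

text \<open>Column \<open>k\<close>, restricted to rows \<open>i\<close> and \<open>j\<close>, lies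
  in the range of the principal block on these indices: by positivity, a kernel vector of the block
  is a kernel vector of the whole matrix.\<close>

lemma pos_semidef_solvable:
  fixes \<rho> :: "complex ^ 'n ^ 'n"
  assumes \<rho>: "pos_semidef \<rho>" and ij: "i \<noteq> j"
  shows "\<exists>x y. \<rho> $ i $ i * x + \<rho> $ i $ j * y = \<rho> $ i $ k \<and> \<rho> $ j $ i * x + \<rho> $ j $ j * y = \<rho> $ j $ k"
proof (cases "\<rho> $ i $ i * \<rho> $ j $ j = \<rho> $ i $ j * \<rho> $ j $ i")
  case False
  let ?D = "\<rho> $ i $ i * \<rho> $ j $ j - \<rho> $ i $ j * \<rho> $ j $ i"
  have D: "?D \<noteq> 0" using False by simp
  \<comment> \<open>Cramer's rule for an invertible block.\<close>
  let ?x = "\<rho>$j$j * \<rho>$i$k - \<rho>$i$j * \<rho>$j$k" and ?y = "\<rho>$i$i * \<rho>$j$k - \<rho>$j$i * \<rho>$i$k"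
  have "\<rho>$i$i * ?x + \<rho>$i$j * ?y = \<rho>$i$k * ?D" "\<rho>$j$i * ?x + \<rho>$j$j * ?y = \<rho>$j$k * ?D"
    by algebra+
  then have "\<rho>$i$i * (?x / ?D) + \<rho>$i$j * (?y / ?D) = \<rho>$i$k \<and> \<rho>$j$i * (?x / ?D) + \<rho>$j$j * (?y / ?D) = \<rho>$j$k"
    unfolding times_divide_eq_right add_divide_distrib[symmetric] using D by simp
  then show ?thesis by blast
next
  case True
  note h = \<rho>[unfolded pos_semidef_def hermitian_def, THEN conjunct1, rule_format]
  show ?thesis
  proof (cases "\<rho> $ i $ i = 0")
    case True
    then have "\<rho> $ i $ j = 0" "\<rho> $ j $ i = 0" "\<rho> $ i $ k = 0"
      using pos_semidef_diag_zero[OF \<rho> True] by auto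
    moreover have "\<exists>y. \<rho> $ j $ j * y = \<rho> $ j $ k"
    proof (cases "\<rho> $ j $ j = 0")
      case True
      then show ?thesis using pos_semidef_diag_zero[OF \<rho> True] by auto
    next
      case False
      then show ?thesis by (intro exI[of _ "\<rho> $ j $ k / \<rho> $ j $ j"]) simp
    qed
    ultimately show ?thesis using True by auto
  next
    case False
    \<comment> \<open>This vector spans the kernel of the singular nonzero block. Row
      \<open>k\<close> of \<open>\<rho> *v u = 0\<close> then makes the two equations proportional,
      so \<open>y = 0\<close> works.\<close>
    define u :: "complex ^ 'n" where "u = (- \<rho> $ i $ j) *s axis i 1 + \<rho> $ i $ i *s axis j 1"
    have \<rho>u: "(\<rho> *v u) $ l = \<rho> $ i $ i * \<rho> $ l $ j - \<rho> $ i $ j * \<rho> $ l $ i" for l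
      unfolding u_def matrix_vector_right_distrib vector_scalar_commute by (simp add: matrix_axis)
    have "cdot u (\<rho> *v u) = 0"
      using True by (subst u_def, unfold cdot_add_left cdot_scale_left cdot_axis \<rho>u) (simp add: mult.commute)
    then have "\<rho> *v u = 0"
      by (intro pos_semidef_kernel[OF \<rho>]) simp
    then have "\<rho> $ i $ i * \<rho> $ k $ j = \<rho> $ i $ j * \<rho> $ k $ i"
      using \<rho>u[of k] by simp
    then have "cnj (\<rho> $ i $ i * \<rho> $ k $ j) = cnj (\<rho> $ i $ j * \<rho> $ k $ i)"
      by simp
    then have "\<rho> $ i $ i * \<rho> $ j $ k = \<rho> $ j $ i * \<rho> $ i $ k"
      unfolding complex_cnj_mult using h by metis
    then show ?thesis
      using False by (intro exI[of _ "\<rho> $ i $ k / \<rho> $ i $ i"] exI[of _ 0]) (simp add: field_simps)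
  qed
qed

text \<open>The unipotent filters subtract \<open>x\<close> times column \<open>(1,1)\<close> and
  \<open>y\<close> times column \<open>(2,2)\<close> from column \<open>(2,1)\<close>, and act
  likewise on rows. All further terms fall on row or column \<open>(1,2)\<close>, which is
  zero.\<close>

lemma kill_coherences:
  fixes \<rho> :: "complex ^ (2 \<times> 2) ^ (2 \<times> 2)"
  assumes \<rho>: "pos_semidef \<rho>" and z: "\<rho> $ (1,2) $ (1,2) = 0"
  shows "\<exists>\<rho>'. loc_equiv \<rho> \<rho>' \<and> \<rho>' $ (1,2) $ (1,2) = 0 \<and> \<rho>' $ (1,1) $ (2,1) = 0 \<and> \<rho>' $ (2,2) $ (2,1) = 0"
proof -
  obtain x y where xy: "\<rho> $ (1,1) $ (1,1) * x + \<rho> $ (1,1) $ (2,2) * y = \<rho> $ (1,1) $ (2,1)"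
    "\<rho> $ (2,2) $ (1,1) * x + \<rho> $ (2,2) $ (2,2) * y = \<rho> $ (2,2) $ (2,1)"
    using pos_semidef_solvable[OF \<rho>, of "(1,1)" "(2,2)" "(2,1)"] by auto
  define A B :: "complex^2^2"
    where "A = vector [vector [1, 0], vector [- cnj x, 1]]"
      and "B = vector [vector [1, - cnj y], vector [0, 1]]"
  have "det A = 1" "det B = 1"
    by (simp_all add: det_2 A_def B_def)
  moreover define \<rho>' where "\<rho>' = (A \<otimes> B) ** \<rho> ** adj (A \<otimes> B)"
  moreover have "\<rho>' $ (1,2) $ (1,2) = 0 \<and> \<rho>' $ (1,1) $ (2,1) = 0 \<and> \<rho>' $ (2,2) $ (2,1) = 0"
    using pos_semidef_diag_zero[OF \<rho> z] xy
    by (simp add: \<rho>'_def tensor_congr_nth sum_UNIV_prod sum_2 A_def B_def) (simp add: algebra_simps)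
  ultimately show ?thesis
    unfolding loc_equiv_def by blast
qed

text \<open>The filter \<open>diag(u, cnj u)\<close> on the first qubit multiplies the entry at
  \<open>(1,1)\<close>, \<open>(2,2)\<close> by \<open>u * u\<close>, so \<open>u\<close> is a
  square root of the phase that makes this entry real.\<close>

lemma phase_coherence:
  fixes \<rho> :: "complex ^ (2 \<times> 2) ^ (2 \<times> 2)"
  assumes z: "\<rho> $ (1,2) $ (1,2) = 0" "\<rho> $ (1,1) $ (2,1) = 0" "\<rho> $ (2,2) $ (2,1) = 0"
  shows "\<exists>\<rho>'. loc_equiv \<rho> \<rho>' \<and> \<rho>' $ (1,2) $ (1,2) = 0 \<and> \<rho>' $ (1,1) $ (2,1) = 0 \<and> \<rho>' $ (2,2) $ (2,1) = 0
    \<and> Im (\<rho>' $ (1,1) $ (2,2)) = 0"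
proof -
  have "\<exists>u. u * cnj u = 1 \<and> Im (u * u * \<rho> $ (1,1) $ (2,2)) = 0"
  proof (cases "\<rho> $ (1,1) $ (2,2) = 0")
    case False
    define z where "z = \<rho> $ (1,1) $ (2,2)"
    define u where "u = csqrt (cnj z / norm z)"
    have uu: "u * u = cnj z / norm z"
      by (metis power2_csqrt power2_eq_square u_def)
    have "norm u * norm u = 1"
      using False by (simp add: norm_mult[symmetric] uu norm_divide z_def)
    then have "u * cnj u = 1"
      by (simp add: complex_norm_square[symmetric] power2_eq_square flip: of_real_mult)
    moreover have "u * u * z = of_real (norm z)"
      using False complex_norm_square[of z, symmetric]
      by (simp add: uu z_def[symmetric] mult.commute[of "cnj z"] power2_eq_square)
    ultimately show ?thesis
      unfolding z_def by (metis Im_complex_of_real)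
  qed (auto intro: exI[of _ 1])
  then obtain u where u: "u * cnj u = 1" "Im (u * u * \<rho> $ (1,1) $ (2,2)) = 0"
    by blast
  define A :: "complex^2^2" where "A = vector [vector [u, 0], vector [0, cnj u]]"
  have "det A = 1" "det (mat 1 :: complex^2^2) = 1"
    using u by (simp_all add: det_2 A_def mat_def)
  moreover define \<rho>' where "\<rho>' = (A \<otimes> mat 1) ** \<rho> ** adj (A \<otimes> mat 1)"
  moreover have "\<rho>' $ (1,2) $ (1,2) = 0 \<and> \<rho>' $ (1,1) $ (2,1) = 0 \<and> \<rho>' $ (2,2) $ (2,1) = 0
    \<and> \<rho>' $ (1,1) $ (2,2) = u * u * \<rho> $ (1,1) $ (2,2)"
    using z
    by (simp add: \<rho>'_def tensor_congr_nth sum_UNIV_prod sum_2 A_def mat_def)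
  ultimately show ?thesis
    unfolding loc_equiv_def using u by metis
qed

text \<open>The corner entry encodes the vanishing population:
  \<open>(pauli 0 + pauli 3) \<otimes> (pauli 0 - pauli 3)\<close> is four times the projector onto
  basis vector \<open>(1,2)\<close>. The only remaining coherence \<open>s\<close> is real and gives
  \<open>d = 2 * s\<close>.\<close>

lemma corr_matrix_X_form:
  assumes \<rho>: "pos_semidef \<rho>"
    and z: "\<rho> $ (1,2) $ (1,2) = 0" "\<rho> $ (1,1) $ (2,1) = 0" "\<rho> $ (2,2) $ (2,1) = 0" "Im (\<rho> $ (1,1) $ (2,2)) = 0"
  shows "\<exists>a b c d. corr_matrix \<rho> =
        vec4 (vec4 a 0 0 b) (vec4 0 d 0 0) (vec4 0 0 (- d) 0) (vec4 c 0 0 (a + c - b))"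
proof -
  note h = \<rho>[unfolded pos_semidef_def hermitian_def, THEN conjunct1, rule_format]
  have z': "\<rho> $ (2,1) $ (1,1) = 0" "\<rho> $ (2,1) $ (2,2) = 0" "\<rho> $ (2,2) $ (1,1) = \<rho> $ (1,1) $ (2,2)"
    using h[of "(2,1)" "(1,1)"] h[of "(2,1)" "(2,2)"] h[of "(2,2)" "(1,1)"] z by (simp_all add: complex_eq_iff)
  define p q r s where "p = Re (\<rho> $ (1,1) $ (1,1))" and "q = Re (\<rho> $ (2,1) $ (2,1))" and "r = Re (\<rho> $ (2,2) $ (2,2))"
    and "s = Re (\<rho> $ (1,1) $ (2,2))"
  have "corr_matrix \<rho> =
        vec4 (vec4 (p + q + r) 0 0 (p + q - r)) (vec4 0 (2 * s) 0 0) (vec4 0 0 (- (2 * s)) 0)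
          (vec4 (p - q - r) 0 0 ((p + q + r) + (p - q - r) - (p + q - r)))"
    using z z' pos_semidef_diag_zero[OF \<rho> z(1)]
    by (simp add: vec_eq_iff forall_4_from_0 corr_matrix_def trace_mult_tensor sum_UNIV_prod sum_2 mat_def p_def q_def r_def s_def)
  then show ?thesis by blast
qed

lemma degenerate_normal_form:
  fixes \<alpha> \<beta> :: "complex ^ 2"
  assumes \<rho>: "pos_semidef \<rho>" and n: "norm \<alpha> = 1" "norm \<beta> = 1"
    and z: "Re (cdot (tvec \<alpha> \<beta>) (\<rho> *v tvec \<alpha> \<beta>)) = 0"
  shows "\<exists>\<rho>' a b c d. loc_equiv \<rho> \<rho>' \<and> corr_matrix \<rho>' =
        vec4 (vec4 a 0 0 b) (vec4 0 d 0 0) (vec4 0 0 (- d) 0) (vec4 c 0 0 (a + c - b))"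
proof -
  obtain \<rho>1 where 1: "loc_equiv \<rho> \<rho>1" "\<rho>1 $ (1,2) $ (1,2) = 0"
    using null_product_to_basis[OF assms] by blast
  then obtain \<rho>2 where 2: "loc_equiv \<rho>1 \<rho>2" "\<rho>2 $ (1,2) $ (1,2) = 0"
      "\<rho>2 $ (1,1) $ (2,1) = 0" "\<rho>2 $ (2,2) $ (2,1) = 0"
    using kill_coherences loc_equiv_pos_semidef[OF 1(1) \<rho>] by blast
  obtain \<rho>3 where 3: "loc_equiv \<rho>2 \<rho>3" "\<rho>3 $ (1,2) $ (1,2) = 0"
      "\<rho>3 $ (1,1) $ (2,1) = 0" "\<rho>3 $ (2,2) $ (2,1) = 0" "Im (\<rho>3 $ (1,1) $ (2,2)) = 0"
    using phase_coherence[OF 2(2-4)] by blast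
  have "loc_equiv \<rho> \<rho>3"
    using 1 2 3 loc_equiv_trans by blast
  with corr_matrix_X_form[OF loc_equiv_pos_semidef[OF this \<rho>] 3(2-)] show ?thesis
    by blast
qed

section \<open>Coercivity and existence of a minimizer on the orbit\<close>

lemma norm_vec_sq: "(norm v)\<^sup>2 = (\<Sum>i\<in>UNIV. (norm (v $ i))\<^sup>2)" for v :: "'a::real_normed_vector ^ 'n"
  by (simp add: norm_vec_def L2_set_def sum_nonneg)

text \<open>The minimum over the compact product of unit spheres is positive, and the form scales
  quadratically in each factor.\<close>

lemma product_form_lower_bound:
  fixes \<rho> :: "complex ^ ('m::finite \<times> 'n::finite) ^ ('m \<times> 'n)"
  assumes \<rho>: "pos_semidef \<rho>"
    and nz: "\<And>\<alpha> \<beta>. norm \<alpha> = 1 \<Longrightarrow> norm \<beta> = 1 \<Longrightarrow> Re (cdot (tvec \<alpha> \<beta>) (\<rho> *v tvec \<alpha> \<beta>)) \<noteq> 0"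
  shows "\<exists>m>0. \<forall>\<alpha> \<beta>. m * (norm \<alpha>)\<^sup>2 * (norm \<beta>)\<^sup>2 \<le> Re (cdot (tvec \<alpha> \<beta>) (\<rho> *v tvec \<alpha> \<beta>))"
proof -
  define q where "q \<alpha> \<beta> = Re (cdot (tvec \<alpha> \<beta>) (\<rho> *v tvec \<alpha> \<beta>))" for \<alpha> :: "complex ^ 'm" and \<beta> :: "complex ^ 'n"
  let ?S = "sphere (0 :: complex ^ 'm) 1 \<times> sphere (0 :: complex ^ 'n) 1"
  have "continuous_on ?S (\<lambda>x. q (fst x) (snd x))"
    unfolding q_def cdot_def matrix_vector_mult_def tvec_def
    by (simp, intro continuous_intros)
  moreover have "(axis undefined 1, axis undefined 1) \<in> ?S"
    by simp
  then have "?S \<noteq> {}"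
    by (metis empty_iff)
  moreover have "compact ?S"
    by (intro compact_Times compact_sphere)
  ultimately have "\<exists>x\<in>?S. \<forall>y\<in>?S. q (fst x) (snd x) \<le> q (fst y) (snd y)"
    by (intro continuous_attains_inf)
  then obtain x where x: "x \<in> ?S" "\<forall>y\<in>?S. q (fst x) (snd x) \<le> q (fst y) (snd y)"
    by (elim bexE)
  define m where "m = q (fst x) (snd x)"
  have "m > 0"
  proof -
    have "m \<ge> 0"
      using \<rho> by (simp add: m_def q_def pos_semidef_iff)
    moreover have "m \<noteq> 0"
      unfolding m_def q_def using x(1) by (intro nz) (auto simp: mem_Times_iff)
    ultimately show ?thesis by simp
  qed
  moreover have "m * (norm \<alpha>)\<^sup>2 * (norm \<beta>)\<^sup>2 \<le> q \<alpha> \<beta>" for \<alpha> \<beta>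
  proof (cases "\<alpha> = 0 \<or> \<beta> = 0")
    case True
    then show ?thesis
      using \<rho> by (auto simp: q_def pos_semidef_iff)
  next
    case False
    define \<alpha>' \<beta>' where "\<alpha>' = inverse (norm \<alpha>) *\<^sub>R \<alpha>" and "\<beta>' = inverse (norm \<beta>) *\<^sub>R \<beta>"
    have "\<alpha> $ i = norm \<alpha> * \<alpha>' $ i" "\<beta> $ j = norm \<beta> * \<beta>' $ j" for i j
      unfolding \<alpha>'_def \<beta>'_def vector_scaleR_component unfolding scaleR_conv_of_real using False by simp_all
    then have "tvec \<alpha> \<beta> $ p = (of_real (norm \<alpha> * norm \<beta>) *s tvec \<alpha>' \<beta>') $ p" for p
      unfolding tvec_def vec_lambda_beta vector_smult_component by (simp only: of_real_mult mult_ac)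
    then have "tvec \<alpha> \<beta> = of_real (norm \<alpha> * norm \<beta>) *s tvec \<alpha>' \<beta>'"
      by (simp only: vec_eq_iff) simp
    then have "cdot (tvec \<alpha> \<beta>) (\<rho> *v tvec \<alpha> \<beta>) =
      of_real ((norm \<alpha> * norm \<beta>)\<^sup>2) * cdot (tvec \<alpha>' \<beta>') (\<rho> *v tvec \<alpha>' \<beta>')"
      by (simp add: vector_scalar_commute cdot_scale_left cdot_scale_right power2_eq_square)
    then have "q \<alpha> \<beta> = (norm \<alpha> * norm \<beta>)\<^sup>2 * q \<alpha>' \<beta>'"
      by (simp add: q_def flip: of_real_mult of_real_power)
    moreover have "m \<le> q \<alpha>' \<beta>'"
      using bspec[OF x(2), of "(\<alpha>', \<beta>')"] False by (simp add: m_def \<alpha>'_def \<beta>'_def)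
    ultimately show ?thesis
      using mult_right_mono[of m "q \<alpha>' \<beta>'" "(norm \<alpha> * norm \<beta>)\<^sup>2"]
      by (simp add: power_mult_distrib mult_ac)
  qed
  ultimately show ?thesis
    unfolding q_def by blast
qed

text \<open>Each diagonal entry is the form at the product of conjugated rows of \<open>A\<close>
  and \<open>B\<close>, and the squared row norms add up to the squared matrix norms.\<close>

lemma trace_congr_lower_bound:
  fixes \<rho> :: "complex ^ ('m::finite \<times> 'n::finite) ^ ('m \<times> 'n)"
  assumes m: "\<And>\<alpha> \<beta>. m * (norm \<alpha>)\<^sup>2 * (norm \<beta>)\<^sup>2 \<le> Re (cdot (tvec \<alpha> \<beta>) (\<rho> *v tvec \<alpha> \<beta>))"
  shows "m * (norm A)\<^sup>2 * (norm B)\<^sup>2 \<le> Re (trace ((A \<otimes> B) ** \<rho> ** adj (A \<otimes> B)))"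
proof -
  have cn: "(norm (\<chi> i. cnj (v $ i)))\<^sup>2 = (norm v)\<^sup>2" for v :: "complex ^ 'k::finite"
    by (simp add: norm_vec_sq)
  have "m * (norm A)\<^sup>2 * (norm B)\<^sup>2 = (\<Sum>a\<in>UNIV. \<Sum>b\<in>UNIV. m * (norm (A $ a))\<^sup>2 * (norm (B $ b))\<^sup>2)"
    by (simp only: norm_vec_sq[of A] norm_vec_sq[of B] mult.assoc sum_product) (simp only: sum_distrib_left)
  also have "\<dots> = (\<Sum>p\<in>UNIV. m * (norm (A $ fst p))\<^sup>2 * (norm (B $ snd p))\<^sup>2)"
    by (simp add: sum_UNIV_prod)
  also have "\<dots> \<le> (\<Sum>p\<in>UNIV. Re (((A \<otimes> B) ** \<rho> ** adj (A \<otimes> B)) $ p $ p))"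
    unfolding congr_diag adj_tensor_axis
    using m[of "\<chi> i. cnj (A $ fst p $ i)" "\<chi> i. cnj (B $ snd p $ i)" for p]
    by (intro sum_mono) (simp add: cn)
  finally show ?thesis
    by (simp add: trace_def)
qed

text \<open>Tensor products of Pauli matrices are Hermitian involutions, and the entry at
  \<open>0\<close>, \<open>0\<close> is the trace.\<close>

lemma corr_matrix_bound:
  assumes \<rho>: "pos_semidef \<rho>"
  shows "\<bar>corr_matrix \<rho> $ i $ j\<bar> \<le> corr_matrix \<rho> $ 0 $ 0"
proof -
  have "hermitian (pauli i \<otimes> pauli j)" "(pauli i \<otimes> pauli j) ** (pauli i \<otimes> pauli j) = mat 1"
    by (simp_all add: hermitian_tensor hermitian_pauli tensor_mult pauli_square tensor_one)
  from trace_involution_bound[OF \<rho> this] show ?thesis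
    by (simp add: corr_matrix_def tensor_one)
qed

text \<open>
  The weights are distinct, and \<open>7\<close> exceeds \<open>3 + 2 + 1\<close>, so that \<open>cost\<close> dominates the trace.
\<close>
definition cost :: "real ^ 4 ^ 4 \<Rightarrow> real" where
  "cost S = 7 * S $ 0 $ 0 - 3 * S $ 1 $ 1 - 2 * S $ 2 $ 2 - S $ 3 $ 3"

text \<open>Six of the seven copies of the entry at \<open>0\<close>, \<open>0\<close> absorb the
  other diagonal entries; the last one is the trace.\<close>

lemma cost_lower_bound:
  assumes \<rho>: "pos_semidef \<rho>"
  shows "Re (trace \<rho>) \<le> cost (corr_matrix \<rho>)"
proof -
  have "Re (trace \<rho>) = corr_matrix \<rho> $ 0 $ 0"
    by (simp add: corr_matrix_def tensor_one)
  with corr_matrix_bound[OF \<rho>, of 1 1] corr_matrix_bound[OF \<rho>, of 2 2] corr_matrix_bound[OF \<rho>, of 3 3]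
  show ?thesis
    unfolding cost_def by linarith
qed

text \<open>Neither filter can shrink to compensate growth of the other, so a bound on the product
  of the norms bounds both.\<close>

lemma norm_sq_ge_det:
  fixes A :: "complex ^ 2 ^ 2"
  assumes "det A = 1"
  shows "2 \<le> (norm A)\<^sup>2"
proof -
  have "1 \<le> norm (A$1$1) * norm (A$2$2) + norm (A$1$2) * norm (A$2$1)"
    using assms norm_triangle_ineq4[of "A$1$1 * A$2$2" "A$1$2 * A$2$1"] by (simp add: det_2 norm_mult)
  also have "2 * \<dots> \<le> (norm A)\<^sup>2"
    using sum_squares_bound[of "norm (A$1$1)" "norm (A$2$2)"] sum_squares_bound[of "norm (A$1$2)" "norm (A$2$1)"]
    by (simp add: norm_vec_sq sum_2)
  finally show ?thesis by simp
qed

lemma cost_minimizer: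
  assumes \<rho>: "pos_semidef \<rho>"
    and nz: "\<And>\<alpha> \<beta>. norm \<alpha> = 1 \<Longrightarrow> norm \<beta> = 1 \<Longrightarrow> Re (cdot (tvec \<alpha> \<beta>) (\<rho> *v tvec \<alpha> \<beta>)) \<noteq> 0"
  shows "\<exists>\<rho>'. loc_equiv \<rho> \<rho>' \<and> (\<forall>\<rho>''. loc_equiv \<rho> \<rho>'' \<longrightarrow> cost (corr_matrix \<rho>') \<le> cost (corr_matrix \<rho>''))"
proof -
  define F where "F x = cost (corr_matrix ((fst x \<otimes> snd x) ** \<rho> ** adj (fst x \<otimes> snd x)))" for x
  obtain m where m: "m > 0" "\<And>\<alpha> \<beta>. m * (norm \<alpha>)\<^sup>2 * (norm \<beta>)\<^sup>2 \<le> Re (cdot (tvec \<alpha> \<beta>) (\<rho> *v tvec \<alpha> \<beta>))"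
    using product_form_lower_bound[OF assms] by blast
  have F_ge: "m * (norm A)\<^sup>2 * (norm B)\<^sup>2 \<le> F (A, B)" for A B
    using trace_congr_lower_bound[OF m(2), of A B] cost_lower_bound[OF pos_semidef_congr[OF \<rho>, of "A \<otimes> B"]]
    by (simp add: F_def)
  define D :: "((complex ^ 2 ^ 2) \<times> (complex ^ 2 ^ 2)) set" where "D = {x. det (fst x) = 1 \<and> det (snd x) = 1}"
  \<comment> \<open>If one norm exceeds \<open>r\<close>, the other squared norm is still at least
    \<open>2\<close>, so \<open>F\<close> exceeds \<open>m * r\<^sup>2 * 2\<close>, its value at the
    identity pair.\<close>
  define r where "r = sqrt (F (mat 1, mat 1) / (2 * m))"
  have far: "F (mat 1, mat 1) < F (A, B)" if "(A, B) \<in> D" "norm A > r \<or> norm B > r" for A B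
  proof -
    have A: "2 \<le> (norm A)\<^sup>2" and B: "2 \<le> (norm B)\<^sup>2"
      using that by (simp_all add: D_def norm_sq_ge_det)
    have prod_gt: "t * 2 < a * b" if "t < a" "0 \<le> t" "2 \<le> b" for t a b :: real
      using mult_left_mono[of 2 b t] mult_strict_right_mono[of t a b] that by linarith
    have "0 \<le> m * (norm (mat 1 :: complex ^ 2 ^ 2))\<^sup>2 * (norm (mat 1 :: complex ^ 2 ^ 2))\<^sup>2"
      using m(1) by simp
    then have "F (mat 1, mat 1) \<ge> 0"
      using F_ge[of "mat 1" "mat 1"] by linarith
    then have r: "r \<ge> 0" "r\<^sup>2 * (2 * m) = F (mat 1, mat 1)"
      using m(1) by (simp_all add: r_def)
    have "F (mat 1, mat 1) < m * (norm A)\<^sup>2 * (norm B)\<^sup>2"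
    proof (cases "norm A > r")
      case True
      then have "r\<^sup>2 < (norm A)\<^sup>2"
        using r by (simp add: power_strict_mono)
      then have "r\<^sup>2 * 2 < (norm A)\<^sup>2 * (norm B)\<^sup>2"
        using B by (intro prod_gt) auto
      with m(1) have "m * (r\<^sup>2 * 2) < m * ((norm A)\<^sup>2 * (norm B)\<^sup>2)"
        by simp
      then show ?thesis
        by (simp add: r(2)[symmetric] mult_ac)
    next
      case False
      then have "r\<^sup>2 < (norm B)\<^sup>2"
        using r that by (simp add: power_strict_mono)
      then have "r\<^sup>2 * 2 < (norm A)\<^sup>2 * (norm B)\<^sup>2"
        using A prod_gt[of "r\<^sup>2" "(norm B)\<^sup>2" "(norm A)\<^sup>2"] by (simp add: mult.commute)
      with m(1) have "m * (r\<^sup>2 * 2) < m * ((norm A)\<^sup>2 * (norm B)\<^sup>2)"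
        by simp
      then show ?thesis
        by (simp add: r(2)[symmetric] mult_ac)
    qed
    with F_ge[of A B] show ?thesis by linarith
  qed
  have one: "(mat 1, mat 1) \<in> D"
    by (simp add: D_def)
  define K where "K = (cball 0 r \<times> cball 0 r) \<inter> D"
  have "closed D"
    unfolding D_def det_2
    by (intro closed_Collect_conj closed_Collect_eq continuous_intros)
  then have "compact K"
    unfolding K_def by (intro compact_Int_closed compact_Times compact_cball)
  \<comment> \<open>Otherwise \<open>far\<close> would put the value at the identity pair strictly
    below itself.\<close>
  moreover have oneK: "(mat 1, mat 1) \<in> K"
  proof -
    have "norm (mat 1 :: complex ^ 2 ^ 2) \<le> r"
      using far[OF one] by (rule_tac ccontr) simp
    then show ?thesis
      using one by (simp add: K_def)
  qed
  moreover have "continuous_on K F"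
    unfolding F_def cost_def corr_matrix_def trace_mult_tensor tensor_congr_nth
    by (simp, intro continuous_intros)
  ultimately have "\<exists>x\<in>K. \<forall>y\<in>K. F x \<le> F y"
    by (intro continuous_attains_inf) auto
  then obtain x where x: "x \<in> K" "\<And>y. y \<in> K \<Longrightarrow> F x \<le> F y"
    by blast
  have min: "F x \<le> F (A, B)" if "(A, B) \<in> D" for A B
  proof (cases "(A, B) \<in> K")
    case False
    then have "F (mat 1, mat 1) < F (A, B)"
      using that by (intro far) (auto simp: K_def)
    with x(2)[OF oneK] show ?thesis by simp
  qed (use x in blast)
  let ?\<rho>' = "(fst x \<otimes> snd x) ** \<rho> ** adj (fst x \<otimes> snd x)"
  have "loc_equiv \<rho> ?\<rho>'"
    using x(1) unfolding loc_equiv_def K_def D_def by auto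
  moreover have "cost (corr_matrix ?\<rho>') \<le> cost (corr_matrix \<rho>'')" if "loc_equiv \<rho> \<rho>''" for \<rho>''
    using that min unfolding loc_equiv_def by (auto simp: D_def F_def)
  ultimately show ?thesis by blast
qed

section \<open>Boosts and rotations in the image of \<open>lor\<close>\<close>

lemma lor_boosts:
  fixes c s :: real
  assumes "c\<^sup>2 - s\<^sup>2 = 1"
  shows "lor (vector [vector [of_real c, of_real s], vector [of_real s, of_real c]]) =
      vec4 (vec4 (c\<^sup>2 + s\<^sup>2) (2 * c * s) 0 0) (vec4 (2 * c * s) (c\<^sup>2 + s\<^sup>2) 0 0) (vec4 0 0 1 0) (vec4 0 0 0 1)"
    and "lor (vector [vector [of_real c, - \<i> * of_real s], vector [\<i> * of_real s, of_real c]]) =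
      vec4 (vec4 (c\<^sup>2 + s\<^sup>2) 0 (2 * c * s) 0) (vec4 0 1 0 0) (vec4 (2 * c * s) 0 (c\<^sup>2 + s\<^sup>2) 0) (vec4 0 0 0 1)"
    and "lor (vector [vector [of_real (c + s), 0], vector [0, of_real (c - s)]]) =
      vec4 (vec4 (c\<^sup>2 + s\<^sup>2) 0 0 (2 * c * s)) (vec4 0 1 0 0) (vec4 0 0 1 0) (vec4 (2 * c * s) 0 0 (c\<^sup>2 + s\<^sup>2))"
  \<comment> \<open>Replacing the entries \<open>1\<close> by \<open>c\<^sup>2 - s\<^sup>2\<close>
    makes each equation a polynomial identity in \<open>c\<close> and \<open>s\<close>.\<close>
  unfolding assms[symmetric]
  by (simp_all add: vec_eq_iff forall_4_from_0 lor_def trace_def matrix_matrix_mult_def sum_2 mat_def power2_eq_square algebra_simps)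

text \<open>The matrices are \<open>c + \<i> s pauli k\<close> for \<open>k = 3, 2, 1\<close>, the
  unitary counterparts of the boost matrices \<open>c + s pauli k\<close>; they rotate the planes
  1-2, 1-3 and 2-3.\<close>

lemma lor_rotations:
  fixes c s :: real
  assumes "c\<^sup>2 + s\<^sup>2 = 1"
  shows "lor (vector [vector [Complex c s, 0], vector [0, Complex c (- s)]]) =
      vec4 (vec4 1 0 0 0) (vec4 0 (c\<^sup>2 - s\<^sup>2) (2 * c * s) 0) (vec4 0 (- (2 * c * s)) (c\<^sup>2 - s\<^sup>2) 0) (vec4 0 0 0 1)"
    and "lor (vector [vector [of_real c, of_real s], vector [- of_real s, of_real c]]) =
      vec4 (vec4 1 0 0 0) (vec4 0 (c\<^sup>2 - s\<^sup>2) 0 (- (2 * c * s))) (vec4 0 0 1 0) (vec4 0 (2 * c * s) 0 (c\<^sup>2 - s\<^sup>2))"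
    and "lor (vector [vector [of_real c, \<i> * of_real s], vector [\<i> * of_real s, of_real c]]) =
      vec4 (vec4 1 0 0 0) (vec4 0 1 0 0) (vec4 0 0 (c\<^sup>2 - s\<^sup>2) (2 * c * s)) (vec4 0 0 (- (2 * c * s)) (c\<^sup>2 - s\<^sup>2))"
  unfolding assms[symmetric]
  by (simp_all add: vec_eq_iff forall_4_from_0 lor_def trace_def matrix_matrix_mult_def sum_2 mat_def power2_eq_square algebra_simps)

lemma boosts_in_image:
  "\<exists>X. det X = 1 \<and> lor X =
      vec4 (vec4 (cosh t) (sinh t) 0 0) (vec4 (sinh t) (cosh t) 0 0) (vec4 0 0 1 0) (vec4 0 0 0 1)"
  "\<exists>X. det X = 1 \<and> lor X =
      vec4 (vec4 (cosh t) 0 (sinh t) 0) (vec4 0 1 0 0) (vec4 (sinh t) 0 (cosh t) 0) (vec4 0 0 0 1)"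
  "\<exists>X. det X = 1 \<and> lor X =
      vec4 (vec4 (cosh t) 0 0 (sinh t)) (vec4 0 1 0 0) (vec4 0 0 1 0) (vec4 (sinh t) 0 0 (cosh t))"
proof -
  \<comment> \<open>Half the parameter, since \<open>lor\<close> is quadratic in its
    argument.\<close>
  define c s where "c = cosh (t / 2)" and "s = sinh (t / 2)"
  have cs: "c\<^sup>2 - s\<^sup>2 = 1"
    by (simp add: c_def s_def cosh_square_eq)
  then have cs': "complex_of_real c * of_real c - of_real s * of_real s = 1"
    by (metis of_real_1 of_real_diff of_real_mult power2_eq_square)
  have t: "cosh t = c\<^sup>2 + s\<^sup>2" "sinh t = 2 * c * s"
    using cosh_double[of "t / 2"] sinh_double[of "t / 2"] by (simp_all add: c_def s_def)
  note * = lor_boosts[OF cs] t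
  show "\<exists>X. det X = 1 \<and> lor X =
      vec4 (vec4 (cosh t) (sinh t) 0 0) (vec4 (sinh t) (cosh t) 0 0) (vec4 0 0 1 0) (vec4 0 0 0 1)"
    using cs' by (intro exI[of _ "vector [vector [of_real c, of_real s], vector [of_real s, of_real c]]"]) (simp add: * det_2)
  show "\<exists>X. det X = 1 \<and> lor X =
      vec4 (vec4 (cosh t) 0 (sinh t) 0) (vec4 0 1 0 0) (vec4 (sinh t) 0 (cosh t) 0) (vec4 0 0 0 1)"
    unfolding t *(2)[symmetric] by (rule exI, rule conjI[OF _ refl]) (use cs' in \<open>simp add: det_2 algebra_simps\<close>)
  show "\<exists>X. det X = 1 \<and> lor X =
      vec4 (vec4 (cosh t) 0 0 (sinh t)) (vec4 0 1 0 0) (vec4 0 0 1 0) (vec4 (sinh t) 0 0 (cosh t))"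
    unfolding t *(3)[symmetric] by (rule exI, rule conjI[OF _ refl]) (use cs' in \<open>simp add: det_2 algebra_simps\<close>)
qed

lemma rotations_in_image:
  "\<exists>X. det X = 1 \<and> lor X =
      vec4 (vec4 1 0 0 0) (vec4 0 (cos t) (sin t) 0) (vec4 0 (- sin t) (cos t) 0) (vec4 0 0 0 1)"
  "\<exists>X. det X = 1 \<and> lor X =
      vec4 (vec4 1 0 0 0) (vec4 0 (cos t) 0 (- sin t)) (vec4 0 0 1 0) (vec4 0 (sin t) 0 (cos t))"
  "\<exists>X. det X = 1 \<and> lor X =
      vec4 (vec4 1 0 0 0) (vec4 0 1 0 0) (vec4 0 0 (cos t) (sin t)) (vec4 0 0 (- sin t) (cos t))"
proof -
  define c s where "c = cos (t / 2)" and "s = sin (t / 2)"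
  have cs: "c\<^sup>2 + s\<^sup>2 = 1"
    by (simp add: c_def s_def)
  then have cs': "complex_of_real c * of_real c + of_real s * of_real s = 1"
    by (metis of_real_1 of_real_add of_real_mult power2_eq_square)
  have t: "cos t = c\<^sup>2 - s\<^sup>2" "sin t = 2 * c * s"
    using cos_double[of "t / 2"] sin_double[of "t / 2"] by (simp_all add: c_def s_def)
  note * = lor_rotations[OF cs]
  show "\<exists>X. det X = 1 \<and> lor X =
      vec4 (vec4 1 0 0 0) (vec4 0 (cos t) (sin t) 0) (vec4 0 (- sin t) (cos t) 0) (vec4 0 0 0 1)"
    unfolding t *(1)[symmetric] by (rule exI, rule conjI[OF _ refl])
      (use cs in \<open>simp add: det_2 complex_eq_iff power2_eq_square\<close>)
  show "\<exists>X. det X = 1 \<and> lor X =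
      vec4 (vec4 1 0 0 0) (vec4 0 (cos t) 0 (- sin t)) (vec4 0 0 1 0) (vec4 0 (sin t) 0 (cos t))"
    unfolding t *(2)[symmetric] by (rule exI, rule conjI[OF _ refl]) (use cs' in \<open>simp add: det_2\<close>)
  show "\<exists>X. det X = 1 \<and> lor X =
      vec4 (vec4 1 0 0 0) (vec4 0 1 0 0) (vec4 0 0 (cos t) (sin t)) (vec4 0 0 (- sin t) (cos t))"
    unfolding t *(3)[symmetric] by (rule exI, rule conjI[OF _ refl]) (use cs' in \<open>simp add: det_2 algebra_simps\<close>)
qed

section \<open>Stationarity and ordering at a minimizer\<close>

lemma cosh_sinh_stationary:
  fixes p q :: real
  assumes "\<And>t. p \<le> p * cosh t + q * sinh t"
  shows "q = 0"
proof -
  have "((\<lambda>t. p * cosh t + q * sinh t) has_real_derivative q) (at 0)"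
    by (auto intro!: derivative_eq_intros)
  from DERIV_local_min[OF this, of 1] show ?thesis
    using assms by simp
qed

lemma cos_sin_stationary:
  fixes p q :: real
  assumes "\<And>t. p \<le> p * cos t + q * sin t"
  shows "q = 0"
proof -
  have "((\<lambda>t. p * cos t + q * sin t) has_real_derivative q) (at 0)"
    by (auto intro!: derivative_eq_intros)
  from DERIV_local_min[OF this, of 1] show ?thesis
    using assms by simp
qed

lemma cost_transpose: "cost (transpose S) = cost S"
  by (simp add: cost_def transpose_def)

text \<open>Each boost or rotation mixes two rows. Along it the cost is a constant plus a
  combination of \<open>cosh\<close> and \<open>sinh\<close>, or of \<open>cos\<close> and
  \<open>sin\<close>, that is minimal at \<open>t = 0\<close>; the vanishing derivative weighs the
  two mirrored off-diagonal entries against each other.\<close>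

lemma stationary_left:
  assumes min: "\<And>X. det X = 1 \<Longrightarrow> cost S \<le> cost (lor X ** S)"
  shows "7 * S$1$0 = 3 * S$0$1" "7 * S$2$0 = 2 * S$0$2" "7 * S$3$0 = S$0$3"
    "3 * S$2$1 = 2 * S$1$2" "3 * S$3$1 = S$1$3" "2 * S$3$2 = S$2$3"
proof -
  note simps = matrix_matrix_mult_def sum_4_from_0 cost_def
  have "7 * S$0$0 - 3 * S$1$1 \<le> (7 * S$0$0 - 3 * S$1$1) * cosh t + (7 * S$1$0 - 3 * S$0$1) * sinh t" for t
  proof -
    obtain X where "det X = 1" "lor X =
      vec4 (vec4 (cosh t) (sinh t) 0 0) (vec4 (sinh t) (cosh t) 0 0) (vec4 0 0 1 0) (vec4 0 0 0 1)"
      using boosts_in_image(1) by blast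
    then show ?thesis using min[of X] by (simp add: simps algebra_simps)
  qed
  from cosh_sinh_stationary[OF this] show "7 * S$1$0 = 3 * S$0$1" by simp
  have "7 * S$0$0 - 2 * S$2$2 \<le> (7 * S$0$0 - 2 * S$2$2) * cosh t + (7 * S$2$0 - 2 * S$0$2) * sinh t" for t
  proof -
    obtain X where "det X = 1" "lor X =
      vec4 (vec4 (cosh t) 0 (sinh t) 0) (vec4 0 1 0 0) (vec4 (sinh t) 0 (cosh t) 0) (vec4 0 0 0 1)"
      using boosts_in_image(2) by blast
    then show ?thesis using min[of X] by (simp add: simps algebra_simps)
  qed
  from cosh_sinh_stationary[OF this] show "7 * S$2$0 = 2 * S$0$2" by simp
  have "7 * S$0$0 - S$3$3 \<le> (7 * S$0$0 - S$3$3) * cosh t + (7 * S$3$0 - S$0$3) * sinh t" for t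
  proof -
    obtain X where "det X = 1" "lor X =
      vec4 (vec4 (cosh t) 0 0 (sinh t)) (vec4 0 1 0 0) (vec4 0 0 1 0) (vec4 (sinh t) 0 0 (cosh t))"
      using boosts_in_image(3) by blast
    then show ?thesis using min[of X] by (simp add: simps algebra_simps)
  qed
  from cosh_sinh_stationary[OF this] show "7 * S$3$0 = S$0$3" by simp
  have "- 3 * S$1$1 - 2 * S$2$2 \<le> (- 3 * S$1$1 - 2 * S$2$2) * cos t + (2 * S$1$2 - 3 * S$2$1) * sin t" for t
  proof -
    obtain X where "det X = 1" "lor X =
      vec4 (vec4 1 0 0 0) (vec4 0 (cos t) (sin t) 0) (vec4 0 (- sin t) (cos t) 0) (vec4 0 0 0 1)"
      using rotations_in_image(1) by blast
    then show ?thesis using min[of X] by (simp add: simps algebra_simps)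
  qed
  from cos_sin_stationary[OF this] show "3 * S$2$1 = 2 * S$1$2" by simp
  have "- 3 * S$1$1 - S$3$3 \<le> (- 3 * S$1$1 - S$3$3) * cos t + (3 * S$3$1 - S$1$3) * sin t" for t
  proof -
    obtain X where "det X = 1" "lor X =
      vec4 (vec4 1 0 0 0) (vec4 0 (cos t) 0 (- sin t)) (vec4 0 0 1 0) (vec4 0 (sin t) 0 (cos t))"
      using rotations_in_image(2) by blast
    then show ?thesis using min[of X] by (simp add: simps algebra_simps)
  qed
  from cos_sin_stationary[OF this] show "3 * S$3$1 = S$1$3" by simp
  have "- 2 * S$2$2 - S$3$3 \<le> (- 2 * S$2$2 - S$3$3) * cos t + (S$2$3 - 2 * S$3$2) * sin t" for t
  proof -
    obtain X where "det X = 1" "lor X =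
      vec4 (vec4 1 0 0 0) (vec4 0 1 0 0) (vec4 0 0 (cos t) (sin t)) (vec4 0 0 (- sin t) (cos t))"
      using rotations_in_image(3) by blast
    then show ?thesis using min[of X] by (simp add: simps algebra_simps)
  qed
  from cos_sin_stationary[OF this] show "2 * S$3$2 = S$2$3" by simp
qed

text \<open>These finite moves exchange diagonal entries up to sign; stationarity alone does not
  order them.\<close>

lemma quarter_turns:
  "\<exists>X. det X = 1 \<and> lor X =
      vec4 (vec4 1 0 0 0) (vec4 0 0 1 0) (vec4 0 (- 1) 0 0) (vec4 0 0 0 1)"
  "\<exists>X. det X = 1 \<and> lor X =
      vec4 (vec4 1 0 0 0) (vec4 0 1 0 0) (vec4 0 0 0 1) (vec4 0 0 (- 1) 0)"
  "\<exists>X. det X = 1 \<and> lor X =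
      vec4 (vec4 1 0 0 0) (vec4 0 1 0 0) (vec4 0 0 0 (- 1)) (vec4 0 0 1 0)"
  using rotations_in_image(1)[of "pi / 2"] rotations_in_image(3)[of "pi / 2"] rotations_in_image(3)[of "- pi / 2"]
  by simp_all

lemma cost_minimal_diagonal:
  assumes min: "\<And>X Y. det X = 1 \<Longrightarrow> det Y = 1 \<Longrightarrow> cost S \<le> cost (lor X ** S ** transpose (lor Y))"
    and bound: "S$1$1 \<le> S$0$0"
  shows "\<exists>s0 s1 s2 s3. S = diag4 s0 s1 s2 s3 \<and> s0 \<ge> s1 \<and> s1 \<ge> s2 \<and> s2 \<ge> \<bar>s3\<bar>"
proof -
  have "cost S \<le> cost (lor X ** S)" if "det X = 1" for X
    using min[OF that, of "mat 1"] by (simp add: lor_one transpose_mat)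
  note left = stationary_left[OF this]
  have "cost (transpose S) \<le> cost (lor X ** transpose S)" if "det X = 1" for X
  proof -
    have "cost (transpose S) \<le> cost (transpose (S ** transpose (lor X)))"
      using min[OF _ that, of "mat 1"] by (simp add: lor_one cost_transpose)
    then show ?thesis by (simp add: matrix_transpose_mul)
  qed
  note right = stationary_left[OF this, unfolded transpose_def vec_lambda_beta]
  \<comment> \<open>Left and right conditions come in pairs such as
    \<open>7 * S$1$0 = 3 * S$0$1\<close> and \<open>7 * S$0$1 = 3 * S$1$0\<close>, which force both
    entries to zero.\<close>
  have off: "S$1$0 = 0" "S$0$1 = 0" "S$2$0 = 0" "S$0$2 = 0" "S$3$0 = 0" "S$0$3 = 0"
    "S$1$2 = 0" "S$2$1 = 0" "S$1$3 = 0" "S$3$1 = 0" "S$2$3 = 0" "S$3$2 = 0"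
    using left right by linarith+
  define s0 s1 s2 s3 where s: "s0 = S$0$0" "s1 = S$1$1" "s2 = S$2$2" "s3 = S$3$3"
  have S: "S = diag4 s0 s1 s2 s3"
    by (simp add: vec_eq_iff forall_4_from_0 diag4_def off s)
  note simps = matrix_matrix_mult_def sum_4_from_0 cost_def transpose_def diag4_def
  obtain X Y Z where XYZ: "det X = 1" "lor X = vec4 (vec4 1 0 0 0) (vec4 0 0 1 0) (vec4 0 (- 1) 0 0) (vec4 0 0 0 1)"
      "det Y = 1" "lor Y = vec4 (vec4 1 0 0 0) (vec4 0 1 0 0) (vec4 0 0 0 1) (vec4 0 0 (- 1) 0)"
      "det Z = 1" "lor Z = vec4 (vec4 1 0 0 0) (vec4 0 1 0 0) (vec4 0 0 0 (- 1)) (vec4 0 0 1 0)"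
    using quarter_turns by blast
  \<comment> \<open>The same turn on both sides exchanges \<open>s1\<close> and \<open>s2\<close>,
    so minimality gives \<open>3 * s1 + 2 * s2 \<ge> 3 * s2 + 2 * s1\<close>.\<close>
  have "s1 \<ge> s2"
    using min[OF XYZ(1) XYZ(1)] unfolding S XYZ by (simp add: simps)
  moreover have "s2 \<ge> s3"
    using min[OF XYZ(3) XYZ(3)] unfolding S XYZ by (simp add: simps)
  \<comment> \<open>Opposite turns on the two sides replace \<open>s2\<close>, \<open>s3\<close> by
    \<open>- s3\<close>, \<open>- s2\<close>.\<close>
  moreover have "s2 \<ge> - s3"
    using min[OF XYZ(3) XYZ(5)] unfolding S XYZ by (simp add: simps)
  moreover have "s0 \<ge> s1"
    using bound by (simp only: s)
  ultimately have "S = diag4 s0 s1 s2 s3 \<and> s0 \<ge> s1 \<and> s1 \<ge> s2 \<and> s2 \<ge> \<bar>s3\<bar>"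
    using S by (simp only: abs_le_iff)
  then show ?thesis by blast
qed

section \<open>Combination of the degenerate and the coercive case\<close>

theorem theorem3:
  fixes \<rho> :: "complex ^ (2 \<times> 2) ^ (2 \<times> 2)"
  assumes "two_qubit_density \<rho>"
  shows "\<exists>L1 \<Sigma> L2 :: real ^ 4 ^ 4.
    proper_orthochronous L1 \<and> proper_orthochronous L2 \<and>
    corr_matrix \<rho> = L1 ** \<Sigma> ** transpose L2 \<and>
    ((\<exists>s0 s1 s2 s3 :: real. \<Sigma> = diag4 s0 s1 s2 s3 \<and> s0 \<ge> s1 \<and> s1 \<ge> s2 \<and> s2 \<ge> \<bar>s3\<bar>) \<or>
     (\<exists>a b c d :: real. \<Sigma> =
        vec4 (vec4 a 0 0 b)
             (vec4 0 d 0 0)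
             (vec4 0 0 (- d) 0)
             (vec4 c 0 0 (a + c - b))))"
proof -
  have \<rho>: "pos_semidef \<rho>"
    using assms by (simp add: two_qubit_density_def)
  show ?thesis
  proof (cases "\<exists>\<alpha> \<beta> :: complex ^ 2. norm \<alpha> = 1 \<and> norm \<beta> = 1 \<and> Re (cdot (tvec \<alpha> \<beta>) (\<rho> *v tvec \<alpha> \<beta>)) = 0")
    case True
    then obtain \<rho>' a b c d where \<rho>': "loc_equiv \<rho> \<rho>'" "corr_matrix \<rho>' =
        vec4 (vec4 a 0 0 b) (vec4 0 d 0 0) (vec4 0 0 (- d) 0) (vec4 c 0 0 (a + c - b))"
      using degenerate_normal_form[OF \<rho>] by blast
    from loc_equiv_corr[OF \<rho>'(1)] obtain L1 L2 where "proper_orthochronous L1" "proper_orthochronous L2"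
      "corr_matrix \<rho> = L1 ** corr_matrix \<rho>' ** transpose L2"
      by blast
    then show ?thesis
      using \<rho>'(2) by blast
  next
    case False
    then obtain \<rho>' where \<rho>': "loc_equiv \<rho> \<rho>'"
      and min: "\<And>\<rho>''. loc_equiv \<rho> \<rho>'' \<Longrightarrow> cost (corr_matrix \<rho>') \<le> cost (corr_matrix \<rho>'')"
      using cost_minimizer[OF \<rho>] by blast
    have "cost (corr_matrix \<rho>') \<le> cost (lor X ** corr_matrix \<rho>' ** transpose (lor Y))"
      if "det X = 1" "det Y = 1" for X Y
    proof -
      have "loc_equiv \<rho>' ((X \<otimes> Y) ** \<rho>' ** adj (X \<otimes> Y))"
        using that unfolding loc_equiv_def by blast
      from min[OF loc_equiv_trans[OF \<rho>' this]] show ?thesis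
        by (simp add: corr_matrix_local)
    qed
    \<comment> \<open>This becomes \<open>s0 \<ge> s1\<close>; it comes from positivity rather than
      from minimality of the cost.\<close>
    moreover have "corr_matrix \<rho>' $ 1 $ 1 \<le> corr_matrix \<rho>' $ 0 $ 0"
      using corr_matrix_bound[OF loc_equiv_pos_semidef[OF \<rho>' \<rho>], of 1 1] by linarith
    ultimately obtain s0 s1 s2 s3 where s: "corr_matrix \<rho>' = diag4 s0 s1 s2 s3"
      "s0 \<ge> s1" "s1 \<ge> s2" "s2 \<ge> \<bar>s3\<bar>"
      using cost_minimal_diagonal[of "corr_matrix \<rho>'"] by blast
    from loc_equiv_corr[OF \<rho>'] obtain L1 L2 where "proper_orthochronous L1" "proper_orthochronous L2"
      "corr_matrix \<rho> = L1 ** corr_matrix \<rho>' ** transpose L2"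
      by blast
    then show ?thesis
      using s by blast
  qed
qed

end
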